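(* Let $d \ge 1$, let $G$ be the disjoint union of $2d-1$ copies of the complete bipartite graph $K_{d,d}$, and let $\mathcal{P} = \{V_1, \ldots, V_{2d}\}$ be a partition of $V(G)$ such that $|V_i| = 2d-1$ for every $i$ and $G$ has no independent transversal with respect to $\mathcal{P}$. Then there exists a component $K_{d,d}$ of $G$ that is contained in the union of two blocks of $\mathcal{P}$.
   Context: For a graph $G$ and a partition $\mathcal{P} = \{V_1, \ldots, V_r\}$ of $V(G)$ into blocks, an independent transversal (IT) of $G$ with respect to $\mathcal{P}$ is an independent set $\{v_1, \ldots, v_r\}$ of $G$ with $v_i \in V_i$ for every $i$. *)

theory Defs
  imports "Graph_Theory.Graph_Theory" "HOL-Library.Disjoint_Sets"
begin

definition disjoint_union_of ::
    "('a, 'b) pre_digraph \<Rightarrow> ('a, 'b) pre_digraph set \<Rightarrow> bool" where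
  "disjoint_union_of G \<H> \<longleftrightarrow>
     (\<forall>H\<in>\<H>. subgraph H G) \<and>
     pairwise (\<lambda>H H'. verts H \<inter> verts H' = {}) \<H> \<and>
     verts G = (\<Union>H\<in>\<H>. verts H) \<and>
     arcs G = (\<Union>H\<in>\<H>. arcs H)"

text \<open>
  An undirected graph is a symmetric digraph (locale \<open>graph\<close>), so its strongly connected
  components are exactly its connected components.
\<close>

abbreviation components :: "('a, 'b) pre_digraph \<Rightarrow> ('a, 'b) pre_digraph set" where
  "components G \<equiv> pre_digraph.sccs G"

definition independent_set :: "('a, 'b) pre_digraph \<Rightarrow> 'a set \<Rightarrow> bool" where
  "independent_set G S \<longleftrightarrow> S \<subseteq> verts G \<and> (\<forall>u\<in>S. \<forall>v\<in>S. \<not> u \<rightarrow>\<^bsub>G\<^esub> v)"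

definition independent_transversal ::
    "('a, 'b) pre_digraph \<Rightarrow> 'a set set \<Rightarrow> 'a set \<Rightarrow> bool" where
  "independent_transversal G \<P> T \<longleftrightarrow>
     independent_set G T \<and> (\<exists>v. (\<forall>B\<in>\<P>. v B \<in> B) \<and> T = v ` \<P>)"

end

theory Submission
  imports Defs
begin

text \<open>
  Read each component as a Boolean variable whose two literals are its sides, and each block as
  the clause of all sides it meets. Picking one side per component is an assignment, so there is
  no independent transversal iff this formula is unsatisfiable. By Tarsi's lemma a minimal
  unsatisfiable set of \<open>m\<close> blocks meets fewer than \<open>m\<close> components, and counting vertices
  (\<open>m (2d - 1) \<le> 2d (m - 1)\<close>) forces \<open>m = 2d\<close>. Hence the formula is minimally unsatisfiable with
  exactly one more clause than variables, and such a formula has a variable that occurs in one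
  clause positively and in one clause negatively.
\<close>

section \<open>Minimally unsatisfiable formulas\<close>

text \<open>The literal \<open>(v, b)\<close> is true under \<open>f\<close> iff
  \<open>f v = b\<close>. Clauses are indexed, so blocks themselves can serve as indices and a
  single clause can be enlarged without touching an equal one.\<close>

definition unsat :: "'j set \<Rightarrow> ('j \<Rightarrow> ('v \<times> bool) set) \<Rightarrow> bool" where
  "unsat J L \<longleftrightarrow> (\<forall>f. \<exists>j\<in>J. \<forall>v. (v, f v) \<notin> L j)"

definition minimally_unsat :: "'j set \<Rightarrow> ('j \<Rightarrow> ('v \<times> bool) set) \<Rightarrow> bool" where
  "minimally_unsat J L \<longleftrightarrow> unsat J L \<and> (\<forall>j\<in>J. \<not> unsat (J - {j}) L)"

definition vars :: "'j set \<Rightarrow> ('j \<Rightarrow> ('v \<times> bool) set) \<Rightarrow> 'v set" where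
  "vars J L = fst ` (\<Union>j\<in>J. L j)"

lemma in_vars_iff: "x \<in> vars J L \<longleftrightarrow> (\<exists>j\<in>J. \<exists>b. (x, b) \<in> L j)"
  unfolding vars_def by force

lemma unsat_mono: "unsat S L \<Longrightarrow> S \<subseteq> J \<Longrightarrow> unsat J L"
  unfolding unsat_def by blast

lemma unsat_antimono_literals:
  "unsat J L' \<Longrightarrow> (\<And>j. j \<in> J \<Longrightarrow> L j \<subseteq> L' j) \<Longrightarrow> unsat J L"
  unfolding unsat_def by blast

lemma minimally_unsat_proper_subset:
  assumes "minimally_unsat J L" "S \<subset> J"
  shows "\<not> unsat S L"
proof
  assume "unsat S L"
  from assms(2) obtain j where "j \<in> J" "S \<subseteq> J - {j}" by blast
  with \<open>unsat S L\<close> assms(1) show False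
    unfolding minimally_unsat_def using unsat_mono by blast
qed

lemma ex_minimally_unsat_subset:
  assumes "finite J" "unsat J L"
  obtains S where "S \<subseteq> J" "minimally_unsat S L"
proof -
  have "\<exists>S\<subseteq>J. minimally_unsat S L"
    using assms
  proof (induction J rule: finite_psubset_induct)
    case (psubset J)
    show ?case
    proof (cases "minimally_unsat J L")
      case False
      then obtain j where "j \<in> J" "unsat (J - {j}) L"
        using psubset.prems unfolding minimally_unsat_def by blast
      with psubset.IH[of "J - {j}"] show ?thesis by blast
    qed blast
  qed
  then show thesis using that by blast
qed

text \<open>If sign \<open>b\<close> never occurred at \<open>x\<close>, a clause \<open>j\<close>
  with the opposite literal could be satisfied by changing \<open>x\<close> alone. By minimality the
  other clauses have a satisfying assignment, and this change cannot spoil it.\<close>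

lemma minimally_unsat_both_signs:
  assumes "minimally_unsat J L" "x \<in> vars J L"
  shows "\<exists>j\<in>J. (x, b) \<in> L j"
proof (rule ccontr)
  assume no: "\<not> (\<exists>j\<in>J. (x, b) \<in> L j)"
  from assms(2) obtain j c where jc: "j \<in> J" "(x, c) \<in> L j"
    unfolding in_vars_iff by blast
  with no have j: "j \<in> J" "(x, \<not> b) \<in> L j" by (cases "c = b"; auto)+
  with assms(1) obtain f where f: "\<forall>i\<in>J - {j}. \<exists>v. (v, f v) \<in> L i"
    unfolding minimally_unsat_def unsat_def by blast
  have "\<exists>v. (v, (f(x := \<not> b)) v) \<in> L i" if "i \<in> J" for i
  proof (cases "i = j")
    case True
    then show ?thesis using j by auto
  next
    case False
    with f that obtain v where v: "(v, f v) \<in> L i" by blast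
    then show ?thesis using no that
      by (intro exI[of _ v]) (cases "v = x"; cases "f v = b"; auto)
  qed
  with assms(1) show False unfolding minimally_unsat_def unsat_def by meson
qed

text \<open>A clause with both literals of \<open>x\<close> is true under every assignment, so
  satisfying the other clauses would satisfy all of them.\<close>

lemma minimally_unsat_no_tautology:
  assumes "minimally_unsat J L" "j \<in> J" "(x, b) \<in> L j"
  shows "(x, \<not> b) \<notin> L j"
proof
  assume taut: "(x, \<not> b) \<in> L j"
  from assms(1,2) obtain f where f: "\<forall>i\<in>J - {j}. \<exists>v. (v, f v) \<in> L i"
    unfolding minimally_unsat_def unsat_def by blast
  have "(x, f x) \<in> L j" using taut assms(3) by (cases "f x = b") auto
  with f have "\<forall>i\<in>J. \<exists>v. (v, f v) \<in> L i" by blast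
  with assms(1) show False unfolding minimally_unsat_def unsat_def by meson
qed

section \<open>Linear algebra and Tarsi's lemma\<close>

text \<open>Gaussian elimination: each equation with a nonzero coefficient is used to eliminate one
  unknown, and a zero equation is dropped.\<close>

lemma homogeneous_system_nontrivial_solution:
  fixes a :: "'e \<Rightarrow> 'x \<Rightarrow> 'k :: field"
  assumes "finite E" "finite X" "card E < card X"
  shows "\<exists>y. (\<exists>x\<in>X. y x \<noteq> 0) \<and> (\<forall>e\<in>E. (\<Sum>x\<in>X. a e x * y x) = 0)"
  using assms
proof (induction E arbitrary: X a rule: finite_induct)
  case empty
  then have "X \<noteq> {}" by auto
  then show ?case by (intro exI[of _ "\<lambda>_. 1"]) auto
next
  case (insert e E)
  show ?case
  proof (cases "\<forall>x\<in>X. a e x = 0")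
    case True
    have "card E < card X" using insert by simp
    from insert.IH[OF insert.prems(1) this, of a] obtain y where
      "\<exists>x\<in>X. y x \<noteq> 0" "\<forall>i\<in>E. (\<Sum>x\<in>X. a i x * y x) = 0" by blast
    with True show ?thesis by (intro exI[of _ y]) auto
  next
    case False
    then obtain p where p: "p \<in> X" "a e p \<noteq> 0" by blast
    \<comment> \<open>Coefficients left after equation \<open>e\<close> is solved for the pivot
      unknown \<open>p\<close> and substituted into the others.\<close>
    define c where "c i x = a i x - a i p * a e x / a e p" for i x
    have "card E < card (X - {p})" using insert p by simp
    from insert.IH[OF _ this, of c] insert.prems(1) obtain y where
      y: "\<exists>x\<in>X - {p}. y x \<noteq> 0" "\<forall>i\<in>E. (\<Sum>x\<in>X - {p}. c i x * y x) = 0" by auto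
    define s where "s = (\<Sum>x\<in>X - {p}. a e x * y x)"
    \<comment> \<open>The value at \<open>p\<close> is the one that equation \<open>e\<close>
      forces.\<close>
    define z where "z = y(p := - s / a e p)"
    have split: "(\<Sum>x\<in>X. a i x * z x) = (\<Sum>x\<in>X - {p}. a i x * y x) - a i p * s / a e p" for i
    proof -
      have "(\<Sum>x\<in>X. a i x * z x) = a i p * z p + (\<Sum>x\<in>X - {p}. a i x * z x)"
        using p insert.prems(1) by (simp add: sum.remove)
      also have "(\<Sum>x\<in>X - {p}. a i x * z x) = (\<Sum>x\<in>X - {p}. a i x * y x)"
        by (intro sum.cong) (auto simp: z_def)
      finally show ?thesis by (simp add: z_def)
    qed
    have "(\<Sum>x\<in>X. a i x * z x) = 0" if "i \<in> E" for i
    proof -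
      have "0 = (\<Sum>x\<in>X - {p}. c i x * y x)" using y(2) that by simp
      also have "\<dots> = (\<Sum>x\<in>X - {p}. a i x * y x - (a i p / a e p) * (a e x * y x))"
        by (intro sum.cong) (auto simp: c_def algebra_simps)
      also have "\<dots> = (\<Sum>x\<in>X - {p}. a i x * y x) - (a i p / a e p) * s"
        unfolding s_def by (simp only: sum_subtractf sum_distrib_left)
      finally show ?thesis unfolding split by simp
    qed
    moreover have "(\<Sum>x\<in>X. a e x * z x) = 0"
      unfolding split using p(2) by (simp add: s_def)
    moreover have "\<exists>x\<in>X. z x \<noteq> 0" using y(1) by (auto simp: z_def)
    ultimately show ?thesis by blast
  qed
qed

text \<open>
  Tarsi's lemma. The clause--variable matrix is given the signs of the literals and vanishing
  column sums. If there were at least as many variables as clauses, it would have a nonzero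
  kernel vector \<open>y\<close>, and a clause meeting the support of \<open>y\<close> could not be orthogonal to \<open>y\<close> without
  being satisfied by the signs of \<open>y\<close>; the remaining clauses are satisfied by minimality.
\<close>

lemma minimally_unsat_card_vars_less:
  fixes L :: "'j \<Rightarrow> ('v \<times> bool) set"
  assumes "finite J" "finite (vars J L)" and mu: "minimally_unsat J L"
  shows "card (vars J L) < card J"
proof (rule ccontr)
  let ?V = "vars J L"
  assume "\<not> card ?V < card J"
  then have le: "card J \<le> card ?V" by simp
  define occ where "occ x b = {j\<in>J. (x, b) \<in> L j}" for x b
  \<comment> \<open>For a variable of the formula, the weights make the positive entries of its
    column sum to 1 and the negative ones to -1.\<close>
  define a :: "'j \<Rightarrow> 'v \<Rightarrow> real" where "a j x =
    (if j \<in> occ x True then 1 / card (occ x True) else 0) -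
    (if j \<in> occ x False then 1 / card (occ x False) else 0)" for j x
  have fin: "finite (occ x b)" for x b using assms(1) by (simp add: occ_def)
  have ne: "card (occ x b) > 0" if "x \<in> ?V" for x b
    using minimally_unsat_both_signs[OF mu that, of b] fin[of x b]
    by (auto simp: occ_def card_gt_0_iff)
  have sum_one: "(\<Sum>j\<in>J. if j \<in> occ x b then 1 / card (occ x b) else (0::real)) = 1"
    if "x \<in> ?V" for x b
  proof -
    have "occ x b \<subseteq> J" by (auto simp: occ_def)
    then have "J \<inter> occ x b = occ x b" by blast
    then show ?thesis using ne[OF that, of b] assms(1) by (simp flip: sum.inter_restrict)
  qed
  have col: "(\<Sum>j\<in>J. a j x) = 0" if "x \<in> ?V" for x
    unfolding a_def sum_subtractf using sum_one[OF that] by simp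
  have "J \<noteq> {}" using mu by (auto simp: minimally_unsat_def unsat_def)
  then obtain j0 where j0: "j0 \<in> J" by blast
  \<comment> \<open>Since the rows add up to zero, the equation of \<open>j0\<close> follows from
    the others. Omitting it leaves fewer equations than unknowns even when clauses and variables are
    equal in number.\<close>
  have "card (J - {j0}) < card ?V" using le j0 assms(1)
    by (metis card_Diff1_less order_less_le_trans)
  from homogeneous_system_nontrivial_solution[OF _ assms(2) this, of a] assms(1)
  obtain y where y: "\<exists>x\<in>?V. y x \<noteq> 0" "\<forall>j\<in>J - {j0}. (\<Sum>x\<in>?V. a j x * y x) = 0"
    by auto
  have "(\<Sum>j\<in>J. \<Sum>x\<in>?V. a j x * y x) = (\<Sum>x\<in>?V. (\<Sum>j\<in>J. a j x) * y x)"
    by (subst sum.swap) (simp add: sum_distrib_right)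
  also have "\<dots> = 0" by (simp add: col)
  finally have "(\<Sum>j\<in>J. \<Sum>x\<in>?V. a j x * y x) = 0" .
  then have "(\<Sum>x\<in>?V. a j0 x * y x) = 0"
    using y(2) j0 assms(1) by (simp add: sum.remove)
  with y(2) have ker: "(\<Sum>x\<in>?V. a j x * y x) = 0" if "j \<in> J" for j
    using that by (cases "j = j0") auto
  \<comment> \<open>The clauses that avoid the support of \<open>y\<close>. They form a proper
    subset of \<open>J\<close>, so some \<open>f\<close> satisfies them all; \<open>g\<close>
    follows \<open>f\<close> off the support and the sign of \<open>y\<close> on it.\<close>
  define R where "R = {j\<in>J. \<forall>x b. (x, b) \<in> L j \<longrightarrow> y x = 0}"
  from y(1) obtain x j b where "j \<in> J" "(x, b) \<in> L j" "y x \<noteq> 0"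
    using in_vars_iff by meson
  then have "j \<in> J - R" by (auto simp: R_def)
  then have "R \<subset> J" by (auto simp: R_def)
  from minimally_unsat_proper_subset[OF mu this] obtain f
    where f: "\<forall>j\<in>R. \<exists>v. (v, f v) \<in> L j" unfolding unsat_def by blast
  define g where "g x = (if y x = 0 then f x else y x > 0)" for x
  have "\<exists>v. (v, g v) \<in> L j" if j: "j \<in> J" for j
  proof (cases "j \<in> R")
    case True
    with f obtain v where "(v, f v) \<in> L j" by blast
    moreover with True have "y v = 0" by (auto simp: R_def)
    ultimately show ?thesis by (intro exI[of _ v]) (simp add: g_def)
  next
    case False
    show ?thesis
    proof (rule ccontr)
      assume no: "\<not> (\<exists>v. (v, g v) \<in> L j)"
      \<comment> \<open>In a clause that \<open>g\<close> falsifies, every literal on the support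
        has the sign opposite to \<open>y\<close>, so its term is negative and nothing can cancel
        it.\<close>
      have neg: "a j x * y x < 0" if "(x, b) \<in> L j" "y x \<noteq> 0" for x b
      proof -
        from j that have xV: "x \<in> ?V" by (auto simp: in_vars_iff)
        from no have ng: "(x, g x) \<notin> L j" by blast
        with that(1) have b: "b = (\<not> g x)" by (cases "b = g x") auto
        show ?thesis
        proof (cases "y x > 0")
          case True
          then have "a j x < 0" using b ng that j ne[OF xV, of False]
            by (auto simp: a_def occ_def g_def)
          with True show ?thesis by (simp add: mult_neg_pos)
        next
          case False
          with that(2) have "y x < 0" by simp
          moreover from False have "a j x > 0" using b ng that j ne[OF xV, of True]
            by (auto simp: a_def occ_def g_def)
          ultimately show ?thesis by (simp add: mult_pos_neg)
        qed
      qed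
      have le0: "a j x * y x \<le> 0" for x
      proof (cases "\<exists>b. (x, b) \<in> L j \<and> y x \<noteq> 0")
        case True
        then show ?thesis using neg by (meson less_imp_le)
      next
        case False
        then show ?thesis by (auto simp: a_def occ_def)
      qed
      from False j obtain x b where x: "(x, b) \<in> L j" "y x \<noteq> 0" by (auto simp: R_def)
      then have "x \<in> ?V" using j by (auto simp: in_vars_iff)
      then have "(\<Sum>x\<in>?V. a j x * y x) < (\<Sum>x\<in>?V. 0)"
        using assms(2) le0 neg[OF x] by (intro sum_strict_mono_ex1) auto
      with ker[OF j] show False by simp
    qed
  qed
  with mu show False unfolding minimally_unsat_def unsat_def by meson
qed

section \<open>Saturation and formulas with one more clause than variables\<close>

text \<open>Adding a literal weakens a clause; here no clause can be weakened further over
  \<open>V\<close> without making the formula satisfiable.\<close>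

definition saturated_unsat :: "'j set \<Rightarrow> 'v set \<Rightarrow> ('j \<Rightarrow> ('v \<times> bool) set) \<Rightarrow> bool" where
  "saturated_unsat J V L \<longleftrightarrow> minimally_unsat J L \<and>
     (\<forall>j\<in>J. \<forall>x\<in>V. \<forall>b. unsat J (L(j := insert (x, b) (L j))) \<longrightarrow> (x, b) \<in> L j)"

text \<open>Among the unsatisfiable extensions of \<open>L\<close> over \<open>V\<close>, one with
  the most literals in total is saturated. It stays minimal because enlarging clauses keeps every
  subformula that was satisfiable satisfiable.\<close>

lemma ex_saturated_unsat:
  assumes "finite J" "finite V" "minimally_unsat J L" "vars J L = V"
  obtains L' where "saturated_unsat J V L'" "vars J L' = V" "\<And>j. j \<in> J \<Longrightarrow> L j \<subseteq> L' j"
proof -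
  define P where "P L' \<longleftrightarrow> unsat J L' \<and> vars J L' = V \<and> (\<forall>j\<in>J. L j \<subseteq> L' j)" for L'
  have sub: "L' j \<subseteq> V \<times> UNIV" if "P L'" "j \<in> J" for L' j
    using that unfolding P_def vars_def by force
  have fin: "finite (V \<times> (UNIV :: bool set))" using assms(2) by simp
  have bound: "(\<Sum>j\<in>J. card (L' j)) \<le> (\<Sum>j\<in>J. card (V \<times> (UNIV :: bool set)))" if "P L'" for L'
    using sub[OF that] fin by (intro sum_mono card_mono) auto
  have "P L" using assms unfolding P_def minimally_unsat_def by blast
  from ex_has_greatest_nat[where P = P and f = "\<lambda>L'. \<Sum>j\<in>J. card (L' j)", OF this] bound
  obtain L' where L': "P L'" and max: "\<And>K. P K \<Longrightarrow> (\<Sum>j\<in>J. card (K j)) \<le> (\<Sum>j\<in>J. card (L' j))"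
    by (metis le_imp_less_Suc)
  have "\<not> unsat (J - {j}) L'" if "j \<in> J" for j
    using that L' assms(3) unsat_antimono_literals[of "J - {j}" L' L]
    unfolding P_def minimally_unsat_def by blast
  then have "minimally_unsat J L'" using L' unfolding P_def minimally_unsat_def by blast
  moreover have "(x, b) \<in> L' j"
    if j: "j \<in> J" and x: "x \<in> V" and u: "unsat J (L'(j := insert (x, b) (L' j)))" for j x b
  proof (rule ccontr)
    assume new: "(x, b) \<notin> L' j"
    let ?K = "L'(j := insert (x, b) (L' j))"
    have "vars J ?K = V" using L' j x unfolding P_def by (fastforce simp: in_vars_iff split: if_splits)
    then have "P ?K" using L' u unfolding P_def by auto
    moreover have "finite (L' j)" using sub[OF L' j] fin finite_subset by blast
    then have "(\<Sum>i\<in>J. card (L' i)) < (\<Sum>i\<in>J. card (?K i))"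
      using new j assms(1) by (intro sum_strict_mono_ex1) auto
    ultimately show False using max by fastforce
  qed
  ultimately have "saturated_unsat J V L'" unfolding saturated_unsat_def by blast
  with L' that show thesis unfolding P_def by blast
qed

text \<open>This is the formula after setting \<open>x\<close> to \<open>b\<close>: satisfied
  clauses disappear and the false literal is struck out. Saturation is what preserves minimality
  here.\<close>

lemma saturated_unsat_restrict:
  assumes "saturated_unsat J V L" "x \<in> V"
  shows "minimally_unsat {j\<in>J. (x, b) \<notin> L j} (\<lambda>j. L j - {(x, \<not> b)})"
proof -
  let ?J = "{j\<in>J. (x, b) \<notin> L j}" and ?L = "\<lambda>j. L j - {(x, \<not> b)}"
  have mu: "minimally_unsat J L" using assms(1) by (simp add: saturated_unsat_def)
  then have uns: "\<exists>j\<in>J. \<forall>v. (v, f v) \<notin> L j" for f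
    by (simp add: minimally_unsat_def unsat_def)
  have "\<exists>j\<in>?J. \<forall>v. (v, f v) \<notin> ?L j" for f
  proof -
    from uns[of "f(x := b)"] obtain j where j: "j \<in> J" "\<forall>v. (v, (f(x := b)) v) \<notin> L j" by blast
    then have xb: "(x, b) \<notin> L j" by (metis fun_upd_same)
    have "(v, f v) \<notin> ?L j" for v
      using j(2)[rule_format, of v] xb by (cases "v = x"; cases "f v = b"; auto)
    with j xb show ?thesis by blast
  qed
  moreover have "\<not> unsat (?J - {d}) ?L" if d: "d \<in> ?J" for d
  proof
    assume u: "unsat (?J - {d}) ?L"
    have pos: "\<exists>j\<in>J - {d}. \<forall>v. (v, f v) \<notin> L j" if "f x = b" for f
    proof -
      from u obtain j where "j \<in> ?J - {d}" "\<forall>v. (v, f v) \<notin> ?L j" unfolding unsat_def by blast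
      with that show ?thesis by auto
    qed
    show False
    proof (cases "(x, \<not> b) \<in> L d")
      case True
      have "\<exists>j\<in>J - {d}. \<forall>v. (v, f v) \<notin> L j" for f
      proof (cases "f x = b")
        case False
        then have "(x, f x) \<in> L d" using True by (cases "f x"; cases b; auto)
        then show ?thesis using uns[of f] by blast
      qed (rule pos)
      with mu d show False unfolding minimally_unsat_def unsat_def by blast
    next
      case False
      \<comment> \<open>If \<open>d\<close> does not mention \<open>x\<close>, then
        \<open>(x, b)\<close> could be added to it: for \<open>x\<close> set to \<open>b\<close> a
        clause other than \<open>d\<close> fails, and otherwise the new literal is false. This
        contradicts saturation.\<close>
      have "\<exists>j\<in>J. \<forall>v. (v, f v) \<notin> (L(d := insert (x, b) (L d))) j" for f
      proof (cases "f x = b")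
        case True
        then show ?thesis using pos[of f] by auto
      next
        case f: False
        from uns[of f] obtain j where "j \<in> J" "\<forall>v. (v, f v) \<notin> L j" by blast
        with f show ?thesis by (intro bexI[of _ j]) auto
      qed
      then have "(x, b) \<in> L d"
        using assms d unfolding saturated_unsat_def unsat_def by blast
      with d show False by simp
    qed
  qed
  ultimately show ?thesis unfolding minimally_unsat_def unsat_def by blast
qed

text \<open>
  A variable \<open>x\<close> of least degree in the saturation works: setting \<open>x\<close> cannot make another variable
  disappear, so Tarsi's lemma applied to the restricted formula bounds the occurrences of each
  literal of \<open>x\<close> by one.
\<close>

lemma minimally_unsat_deficiency_one:
  assumes "finite J" "minimally_unsat J L" "card J = card (vars J L) + 1" "vars J L \<noteq> {}"
    and finV: "finite (vars J L)"
  obtains x where "x \<in> vars J L" "\<And>b. card {j\<in>J. (x, b) \<in> L j} = 1"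
proof -
  let ?V = "vars J L"
  obtain L' where sat: "saturated_unsat J ?V L'" and V: "vars J L' = ?V"
    and ext: "\<And>j. j \<in> J \<Longrightarrow> L j \<subseteq> L' j"
    using ex_saturated_unsat[OF assms(1) finV assms(2) refl] by blast
  have mu: "minimally_unsat J L'" using sat by (simp add: saturated_unsat_def)
  define occ where "occ x b = {j\<in>J. (x, b) \<in> L' j}" for x b
  define deg where "deg x = card (occ x True \<union> occ x False)" for x
  have fin: "finite (occ x b)" for x b using assms(1) by (simp add: occ_def)
  obtain x where x: "x \<in> ?V" and min: "\<And>y. y \<in> ?V \<Longrightarrow> deg x \<le> deg y"
    using arg_min_if_finite[OF finV assms(4), of deg] by (meson not_le)
  have "card {j\<in>J. (x, b) \<in> L j} = 1" for b
  proof -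
    let ?J = "{j\<in>J. (x, b) \<notin> L' j}" and ?K = "\<lambda>j. L' j - {(x, \<not> b)}"
    \<comment> \<open>The opposite literal occurs in a clause without \<open>(x, b)\<close>, so
      \<open>(x, b)\<close> occurs in strictly fewer clauses than the degree of
      \<open>x\<close>.\<close>
    obtain i where i: "i \<in> J" "(x, \<not> b) \<in> L' i"
      using minimally_unsat_both_signs[OF mu] x V by blast
    then have "(x, b) \<notin> L' i" using minimally_unsat_no_tautology[OF mu i] by simp
    then have "occ x b \<subset> occ x True \<union> occ x False"
      using i by (cases b) (auto simp: occ_def)
    then have less: "card (occ x b) < deg x"
      unfolding deg_def using fin by (intro psubset_card_mono) auto
    have vars: "vars ?J ?K = ?V - {x}"
    proof
      show "vars ?J ?K \<subseteq> ?V - {x}"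
      proof
        fix y assume "y \<in> vars ?J ?K"
        then obtain j c where *: "j \<in> J" "(x, b) \<notin> L' j" "(y, c) \<in> L' j" "(y, c) \<noteq> (x, \<not> b)"
          unfolding in_vars_iff by blast
        then have "y \<in> ?V" unfolding V[symmetric] in_vars_iff by blast
        moreover have "y \<noteq> x" using * by (cases b; cases c; auto)
        ultimately show "y \<in> ?V - {x}" by simp
      qed
      show "?V - {x} \<subseteq> vars ?J ?K"
      proof
        fix y assume y: "y \<in> ?V - {x}"
        \<comment> \<open>A variable \<open>y\<close> that vanished with the satisfied clauses would
          have smaller degree than \<open>x\<close>.\<close>
        have "\<not> occ y True \<union> occ y False \<subseteq> occ x b"
        proof
          assume "occ y True \<union> occ y False \<subseteq> occ x b"
          then have "deg y \<le> card (occ x b)" unfolding deg_def by (intro card_mono fin)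
          with less min[of y] y show False by simp
        qed
        then obtain j c where "j \<in> J" "(y, c) \<in> L' j" "(x, b) \<notin> L' j"
          by (auto simp: occ_def)
        with y show "y \<in> vars ?J ?K" unfolding in_vars_iff by blast
      qed
    qed
    \<comment> \<open>With \<open>n\<close> variables this reads
      \<open>n - 1 < n + 1 - card (occ x b)\<close>, which leaves at most one occurrence.\<close>
    have "card (vars ?J ?K) < card ?J"
      using assms(1) finV saturated_unsat_restrict[OF sat x]
      by (intro minimally_unsat_card_vars_less) (auto simp: vars)
    moreover have "?J = J - occ x b" by (auto simp: occ_def)
    then have "card ?J = card J - card (occ x b)"
      using fin by (simp add: card_Diff_subset occ_def)
    moreover have "card (vars ?J ?K) = card ?V - 1" using x vars finV by simp
    ultimately have "card (occ x b) \<le> 1" using assms(3) by linarith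
    \<comment> \<open>Back to the original clauses: they have no more occurrences than the saturated
      ones, and at least one of each sign.\<close>
    moreover have "card {j\<in>J. (x, b) \<in> L j} \<le> card (occ x b)"
      using ext fin unfolding occ_def by (intro card_mono) (auto simp: assms(1))
    moreover have "card {j\<in>J. (x, b) \<in> L j} > 0"
      using minimally_unsat_both_signs[OF assms(2) x, of b] assms(1)
      by (auto simp: card_gt_0_iff)
    ultimately show ?thesis by linarith
  qed
  with x that show thesis by blast
qed

section \<open>Disjoint unions of complete bipartite graphs\<close>

text \<open>The arc comes from some summand, which contains its tail; disjointness makes that
  summand \<open>H\<close>.\<close>

lemma disjoint_union_of_closed:
  assumes "disjoint_union_of G \<H>" "H \<in> \<H>" "u \<in> verts H" "u \<rightarrow>\<^bsub>G\<^esub> v"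
  shows "u \<rightarrow>\<^bsub>H\<^esub> v" and "v \<in> verts H"
proof -
  from assms(4) obtain e where e: "e \<in> arcs G" "tail G e = u" "head G e = v" by blast
  with assms(1) obtain H' where H': "H' \<in> \<H>" "e \<in> arcs H'"
    unfolding disjoint_union_of_def by blast
  with assms(1) have sub: "subgraph H' G" unfolding disjoint_union_of_def by blast
  then have wf: "wf_digraph H'" and eq: "tail H' e = u" "head H' e = v"
    using e by (auto simp: subgraph_def compatible_def)
  then have "u \<rightarrow>\<^bsub>H'\<^esub> v" using H'(2) by (auto simp: arcs_ends_conv)
  moreover have "u \<in> verts H'" "v \<in> verts H'"
    using wf eq H'(2) wf_digraph.wellformed by metis+
  moreover have "H' = H"
    using assms(1,2,3) H'(1) \<open>u \<in> verts H'\<close> unfolding disjoint_union_of_def pairwise_def by blast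
  ultimately show "u \<rightarrow>\<^bsub>H\<^esub> v" "v \<in> verts H" by auto
qed

text \<open>Every arc of \<open>G\<close> that starts in \<open>H\<close> lies in \<open>H\<close>.
  Hence \<open>H\<close> is induced, and a larger strongly connected subgraph would need a path
  leaving \<open>H\<close>.\<close>

lemma strongly_connected_summand_in_components:
  assumes "disjoint_union_of G \<H>" "H \<in> \<H>" "strongly_connected H"
  shows "H \<in> components G"
proof -
  have sub: "subgraph H G" using assms(1,2) by (simp add: disjoint_union_of_def)
  have "e \<in> arcs H" if e: "e \<in> arcs G" "tail G e \<in> verts H" for e
  proof -
    from e(1) assms(1) obtain H' where H': "H' \<in> \<H>" "e \<in> arcs H'"
      unfolding disjoint_union_of_def by blast
    with assms(1) have "subgraph H' G" unfolding disjoint_union_of_def by blast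
    then have "tail G e \<in> verts H'" using H'(2)
      by (metis compatible_tail subgraph_def wf_digraph.tail_in_verts)
    with e(2) assms(1,2) H'(1) have "H' = H"
      unfolding disjoint_union_of_def pairwise_def by blast
    with H' show ?thesis by simp
  qed
  moreover have "tail G e \<in> verts H \<and> head G e \<in> verts H" "e \<in> arcs G" if "e \<in> arcs H" for e
    using sub that unfolding subgraph_def
    by (metis compatible_tail compatible_head wf_digraph.wellformed, blast)
  ultimately have ind: "induced_subgraph H G"
    using sub unfolding induced_subgraph_def by blast
  have False if H': "induced_subgraph H' G" "strongly_connected H'" "verts H \<subset> verts H'" for H'
  proof -
    from assms(3) obtain u where u: "u \<in> verts H" by (auto simp: strongly_connected_def)
    from H'(3) obtain w where w: "w \<in> verts H'" "w \<notin> verts H" by blast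
    have "u \<rightarrow>\<^sup>*\<^bsub>H'\<^esub> w" using H'(2,3) u w by (auto simp: strongly_connected_def)
    moreover have sub': "subgraph H' G" using H'(1) by (simp add: induced_subgraph_def)
    ultimately have "(u, w) \<in> (arcs_ends H')\<^sup>*" by (simp add: reachable_rtranclI)
    then have "w \<in> verts H"
    proof (induction rule: rtrancl_induct)
      case base
      show ?case by (rule u)
    next
      case (step y z)
      have "arcs_ends H' \<subseteq> arcs_ends G"
        using sub' by (auto simp: arcs_ends_conv subgraph_def compatible_def)
      with step show ?case using disjoint_union_of_closed(2)[OF assms(1,2)] by blast
    qed
    with w show False by simp
  qed
  with ind assms(3) show ?thesis unfolding pre_digraph.sccs_def by blast
qed

text \<open>With \<open>p\<close> and \<open>q\<close> fixed on opposite sides, every vertex is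
  joined to \<open>p\<close> directly or through \<open>q\<close>, in both directions.\<close>

lemma complete_bipartite_strongly_connected:
  assumes "K\<^bsub>m,n\<^esub> H" "m \<ge> 1" "n \<ge> 1"
  shows "strongly_connected H"
proof -
  interpret graph H using assms(1) by (simp add: complete_bipartite_digraph_def)
  obtain U W where UW: "verts H = U \<union> W" "card U = m" "card W = n"
    "arcs_ends H = U \<times> W \<union> W \<times> U"
    using assms(1) unfolding complete_bipartite_digraph_def by blast
  from UW assms(2,3) have "U \<noteq> {}" "W \<noteq> {}" by force+
  then obtain p q where pq: "p \<in> U" "q \<in> W" by blast
  have "u \<rightarrow>\<^sup>*\<^bsub>H\<^esub> p" "p \<rightarrow>\<^sup>*\<^bsub>H\<^esub> u" if "u \<in> verts H" for u
  proof -
    have "p \<rightarrow>\<^bsub>H\<^esub> q" "q \<rightarrow>\<^bsub>H\<^esub> p" using pq UW by auto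
    then have pq': "p \<rightarrow>\<^sup>*\<^bsub>H\<^esub> q" "q \<rightarrow>\<^sup>*\<^bsub>H\<^esub> p" by auto
    have "u \<rightarrow>\<^sup>*\<^bsub>H\<^esub> p \<and> p \<rightarrow>\<^sup>*\<^bsub>H\<^esub> u"
    proof (cases "u \<in> U")
      case True
      then have "u \<rightarrow>\<^bsub>H\<^esub> q" "q \<rightarrow>\<^bsub>H\<^esub> u" using pq UW by auto
      then show ?thesis using pq' by (meson adj_reachable_trans reachable_adj_trans)
    next
      case False
      then have "u \<rightarrow>\<^bsub>H\<^esub> p" "p \<rightarrow>\<^bsub>H\<^esub> u" using that pq UW by auto
      then show ?thesis by auto
    qed
    then show "u \<rightarrow>\<^sup>*\<^bsub>H\<^esub> p" "p \<rightarrow>\<^sup>*\<^bsub>H\<^esub> u" by auto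
  qed
  moreover have "verts H \<noteq> {}" using pq UW by auto
  ultimately show ?thesis by (meson reachable_trans strongly_connectedI)
qed

section \<open>From transversals to formulas and back\<close>

theorem corollary17:
  fixes G :: "('a, 'b) pre_digraph"
    and \<H> :: "('a, 'b) pre_digraph set"
    and \<P> :: "'a set set"
    and d :: nat
  assumes "d \<ge> 1"
    and "graph G"
    and "disjoint_union_of G \<H>"
    and "card \<H> = 2 * d - 1"
    and "\<And>H. H \<in> \<H> \<Longrightarrow> K\<^bsub>d,d\<^esub> H"
    and "partition_on (verts G) \<P>"
    and "card \<P> = 2 * d"
    and "\<And>B. B \<in> \<P> \<Longrightarrow> card B = 2 * d - 1"
    and "\<not> (\<exists>T. independent_transversal G \<P> T)"
  shows "\<exists>C\<in>components G. K\<^bsub>d,d\<^esub> C \<and> (\<exists>A\<in>\<P>. \<exists>B\<in>\<P>. A \<noteq> B \<and> verts C \<subseteq> A \<union> B)"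
proof -
  interpret graph G by fact
  \<comment> \<open>Infinite sets have cardinality 0, so \<open>d \<ge> 1\<close> makes both
    families finite.\<close>
  have finH: "finite \<H>" and finP: "finite \<P>"
    using assms(1,4,7) by (auto intro: card_ge_0_finite)
  have G_verts: "verts G = (\<Union>H\<in>\<H>. verts H)"
    using assms(3) by (simp add: disjoint_union_of_def)
  have P_union: "\<Union>\<P> = verts G" using assms(6) by (simp add: partition_on_def)
  have finB: "finite B" if "B \<in> \<P>" for B
    using that P_union finite_verts by (metis Sup_upper finite_subset)
  have same: "H = H'" if "H \<in> \<H>" "H' \<in> \<H>" "v \<in> verts H" "v \<in> verts H'" for H H' v
    using assms(3) that unfolding disjoint_union_of_def pairwise_def by blast
  have "\<exists>s. verts H = s True \<union> s False \<and> s True \<inter> s False = {} \<and> (\<forall>b. card (s b) = d) \<and>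
      arcs_ends H = s True \<times> s False \<union> s False \<times> s True" if "H \<in> \<H>" for H
  proof -
    from assms(5)[OF that] obtain U W where "verts H = U \<union> W" "U \<inter> W = {}" "card U = d" "card W = d"
      "arcs_ends H = U \<times> W \<union> W \<times> U" unfolding complete_bipartite_digraph_def by blast
    then show ?thesis by (intro exI[of _ "\<lambda>b. if b then U else W"]) simp
  qed
  then obtain side where side: "\<And>H. H \<in> \<H> \<Longrightarrow> verts H = side H True \<union> side H False"
    "\<And>H. H \<in> \<H> \<Longrightarrow> side H True \<inter> side H False = {}"
    "\<And>H b. H \<in> \<H> \<Longrightarrow> card (side H b) = d"
    "\<And>H. H \<in> \<H> \<Longrightarrow> arcs_ends H = side H True \<times> side H False \<union> side H False \<times> side H True"
    by metis
  have side_sub: "side H b \<subseteq> verts H" if "H \<in> \<H>" for H b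
    using side(1)[OF that] by (cases b) auto
  have side_ne: "side H b \<noteq> {}" if "H \<in> \<H>" for H b
    using side(3)[OF that, of b] assms(1) by auto
  have card_H: "card (verts H) = 2 * d" if "H \<in> \<H>" for H
  proof -
    have "finite (side H b)" for b
      using side(3)[OF that, of b] assms(1) by (intro card_ge_0_finite) simp
    then show ?thesis using that side by (simp add: card_Un_disjoint)
  qed
  define L where "L B = {(H, b). H \<in> \<H> \<and> side H b \<inter> B \<noteq> {}}" for B
  have uns: "unsat \<P> L"
    unfolding unsat_def
  proof (rule ccontr, clarsimp)
    fix f assume "\<forall>B\<in>\<P>. \<exists>H. (H, f H) \<in> L B"
    then have "\<forall>B\<in>\<P>. \<exists>v H. H \<in> \<H> \<and> v \<in> side H (f H) \<and> v \<in> B"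
      unfolding L_def by blast
    then obtain v h where v: "\<And>B. B \<in> \<P> \<Longrightarrow> h B \<in> \<H> \<and> v B \<in> side (h B) (f (h B)) \<and> v B \<in> B"
      by metis
    \<comment> \<open>Adjacent representatives would lie in one component, both on the side selected
      by \<open>f\<close>, and a side spans no arc.\<close>
    have "\<not> v A \<rightarrow>\<^bsub>G\<^esub> v B" if AB: "A \<in> \<P>" "B \<in> \<P>" for A B
    proof
      assume arc: "v A \<rightarrow>\<^bsub>G\<^esub> v B"
      have inA: "v A \<in> verts (h A)" and inB: "v B \<in> verts (h B)"
        using v[OF AB(1)] v[OF AB(2)] side_sub by blast+
      note cl = disjoint_union_of_closed[OF assms(3) _ inA arc]
      have "h A = h B" using same cl(2) inB v AB by blast
      then have "v A \<in> side (h A) (f (h A))" "v B \<in> side (h A) (f (h A))"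
        using v[OF AB(1)] v[OF AB(2)] by auto
      with cl(1) side(2,4)[of "h A"] v[OF AB(1)] show False by (cases "f (h A)") auto
    qed
    moreover have "v ` \<P> \<subseteq> verts G" using v P_union by blast
    ultimately have "independent_transversal G \<P> (v ` \<P>)"
      unfolding independent_transversal_def independent_set_def using v by (auto intro!: exI[of _ v])
    with assms(9) show False by blast
  qed
  have vars_iff: "H \<in> vars S L \<longleftrightarrow> H \<in> \<H> \<and> verts H \<inter> \<Union>S \<noteq> {}" for H S
    unfolding in_vars_iff L_def using side(1) by (auto 4 4 simp: ex_bool_eq)
  have fin_vars: "finite (vars S L)" for S
    using finH vars_iff by (meson finite_subset subsetI)
  obtain S where S: "S \<subseteq> \<P>" "minimally_unsat S L"
    using ex_minimally_unsat_subset[OF finP uns] by blast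
  have finS: "finite S" using S(1) finP finite_subset by blast
  \<comment> \<open>Start of the vertex count: the blocks in \<open>S\<close> lie inside the
    components that they meet.\<close>
  have "\<Union>S \<subseteq> (\<Union>H\<in>vars S L. verts H)"
  proof
    fix u assume u: "u \<in> \<Union>S"
    then have "u \<in> verts G" using S(1) P_union by blast
    then obtain H where "H \<in> \<H>" "u \<in> verts H" using G_verts by blast
    with u show "u \<in> (\<Union>H\<in>vars S L. verts H)" using vars_iff by blast
  qed
  moreover have "finite (verts H)" if "H \<in> vars S L" for H
    using that vars_iff card_H assms(1) by (intro card_ge_0_finite) auto
  ultimately have "card (\<Union>S) \<le> card (\<Union>H\<in>vars S L. verts H)"
    using fin_vars by (intro card_mono) auto
  also have "\<dots> \<le> (\<Sum>H\<in>vars S L. card (verts H))" by (rule card_UN_le[OF fin_vars])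
  also have "\<dots> = card (vars S L) * (2 * d)"
    using vars_iff card_H by simp
  also have "card (\<Union>S) = card S * (2 * d - 1)"
  proof -
    have "disjoint \<P>" using assms(6) by (simp add: partition_on_def)
    then have "card (\<Union>S) = (\<Sum>B\<in>S. card B)"
      using S(1) finB by (intro card_Union_disjoint) (auto simp: disjoint_def pairwise_def disjnt_def)
    also have "\<dots> = (\<Sum>B\<in>S. 2 * d - 1)" using S(1) assms(8) by (intro sum.cong) auto
    finally show ?thesis by simp
  qed
  finally have count: "card S * (2 * d - 1) \<le> card (vars S L) * (2 * d)" .
  have less: "card (vars S L) < card S"
    using minimally_unsat_card_vars_less[OF finS fin_vars S(2)] .
  \<comment> \<open>With \<open>m = card S\<close> and at most \<open>m - 1\<close> components met,
    the count gives \<open>m * (2 * d - 1) + 2 * d \<le> m * (2 * d)\<close>, that is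
    \<open>2 * d \<le> m\<close>.\<close>
  have "2 * d \<le> card S"
  proof -
    have "card S * (2 * d - 1) + 2 * d \<le> (card (vars S L) + 1) * (2 * d)"
      using count by simp
    also have "\<dots> \<le> card S * (2 * d)" using less by (intro mult_right_mono) auto
    also have "\<dots> = card S * (2 * d - 1) + card S"
      using assms(1) by (cases d) auto
    finally show ?thesis by simp
  qed
  then have "S = \<P>" using S(1) finP assms(7) by (metis card_seteq)
  then have mu: "minimally_unsat \<P> L" using S by simp
  have "verts H \<inter> \<Union>\<P> \<noteq> {}" if "H \<in> \<H>" for H
    using that side_ne[OF that, of True] side_sub[OF that, of True] P_union G_verts by blast
  then have vars: "vars \<P> L = \<H>" using vars_iff by blast
  have "vars \<P> L \<noteq> {}" using vars assms(1,4) by auto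
  moreover have "card \<P> = card (vars \<P> L) + 1" using vars assms(1,4,7) by simp
  ultimately obtain H where H: "H \<in> \<H>" and one: "\<And>b. card {B\<in>\<P>. (H, b) \<in> L B} = 1"
    using minimally_unsat_deficiency_one[OF finP mu _ _ fin_vars] vars by metis
  \<comment> \<open>A literal occurring in a single clause is a side meeting a single block; as the
    blocks cover all vertices, that block contains the side.\<close>
  have "\<exists>A\<in>\<P>. side H b \<subseteq> A" for b
  proof -
    from one[of b] obtain A where A: "{B\<in>\<P>. (H, b) \<in> L B} = {A}" by (auto simp: card_1_singleton_iff)
    have "u \<in> A" if u: "u \<in> side H b" for u
    proof -
      have "u \<in> \<Union>\<P>" using u side_sub[OF H] H P_union G_verts by blast
      then obtain B where B: "B \<in> \<P>" "u \<in> B" by blast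
      then have "B \<in> {B\<in>\<P>. (H, b) \<in> L B}" using u H by (auto simp: L_def)
      with A B show ?thesis by blast
    qed
    with A show ?thesis by blast
  qed
  then obtain A B where AB: "A \<in> \<P>" "B \<in> \<P>" "side H True \<subseteq> A" "side H False \<subseteq> B" by blast
  then have sub: "verts H \<subseteq> A \<union> B" using side(1)[OF H] by blast
  \<comment> \<open>One block is too small by one vertex to hold all \<open>2 * d\<close> vertices
    of \<open>H\<close>.\<close>
  have "A \<noteq> B"
  proof
    assume "A = B"
    with sub AB have "card (verts H) \<le> card A" using finB by (intro card_mono) auto
    with card_H[OF H] assms(1,8) AB(1) show False by simp
  qed
  moreover have "H \<in> components G"
    using strongly_connected_summand_in_components[OF assms(3) H]
      complete_bipartite_strongly_connected[OF assms(5)[OF H]] assms(1) by blast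
  ultimately show ?thesis using assms(5)[OF H] AB sub by blast
qed

end
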